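(* Let $\mu$ be a finite nonnegative measure in $\mathbb{R}^N$ such that for every Borel set $A \subset \mathbb{R}^N$, $\mathcal{H}^{N-1}(A) < +\infty$ implies $\mu(A) = 0$. Then there exists a nondecreasing sequence of finite nonnegative measures $(\mu_n)_{n \in \mathbb{N}}$ in $\mathbb{R}^N$ such that $$\lim_{n \to \infty} \|\mu_n - \mu\|_{\mathcal{M}(\mathbb{R}^N)} = 0,$$ and for every $n \in \mathbb{N}$, $$\lim_{\delta \to 0} \ \sup_{\substack{x \in \mathbb{R}^N\\ 0 < r \le \delta}} \frac{\mu_n(B(x; r))}{r^{N-1}} = 0.$$
   Context: $N\ge1$ is an integer. Measures are Borel measures in $\mathbb{R}^N$. $\|\nu\|_{\mathcal{M}(\mathbb{R}^N)} = |\nu|(\mathbb{R}^N)$ is the total mass (total variation) norm. A sequence of measures is nondecreasing if $\mu_n(A) \le \mu_{n+1}(A)$ for every Borel set $A$ and every $n$. $B(x;r)$ is the ball of center $x$ and radius $r$. $\mathcal{H}^{N-1}$ is the (spherical) Hausdorff measure of dimension $s=N-1$: $\mathcal{H}^{s}(A) = \lim_{\delta\to 0} \inf\{\sum_{n=0}^\infty \omega_s r_n^s : A \subset \bigcup_{n=0}^\infty B(x_n;r_n),\ 0\le r_n \le \delta\}$ with $\omega_s = \pi^{s/2}/\Gamma(\frac{s}{2}+1)$ (for $s=0$, $\mathcal{H}^0$ is the counting measure). *)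

theory Defs
  imports "HOL-Analysis.Analysis"
begin

(* unit_ball_vol s is pi^(s/2) / Gamma(s/2 + 1) for every real s.
   The balls are open, so those with radius 0 are empty and only pad a finite cover;
   since 0 powr s = 0 also when s = 0, they contribute nothing to the sum.
   In particular the limit below is the counting measure when s = 0. *)
definition hausdorff_content :: "real \<Rightarrow> real \<Rightarrow> 'a::metric_space set \<Rightarrow> ennreal" where
  "hausdorff_content s \<delta> A =
     Inf {(\<Sum>n. ennreal (unit_ball_vol s * r n powr s)) | (x :: nat \<Rightarrow> 'a) (r :: nat \<Rightarrow> real).
            A \<subseteq> (\<Union>n. ball (x n) (r n)) \<and> (\<forall>n. 0 \<le> r n \<and> r n \<le> \<delta>)}"

definition hausdorff_measure :: "real \<Rightarrow> 'a::metric_space set \<Rightarrow> ennreal" where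
  "hausdorff_measure s A = Lim (at_right 0) (\<lambda>\<delta>. hausdorff_content s \<delta> A)"

lemma hausdorff_content_antimono:
  assumes "\<delta> \<le> \<delta>'"
  shows "hausdorff_content s \<delta>' A \<le> hausdorff_content s \<delta> A"
proof (unfold hausdorff_content_def, rule Inf_superset_mono, safe)
  fix x :: "nat \<Rightarrow> 'a" and r :: "nat \<Rightarrow> real"
  assume "A \<subseteq> (\<Union>n. ball (x n) (r n))" "\<forall>n. 0 \<le> r n \<and> r n \<le> \<delta>"
  moreover from this(2) have "\<forall>n. 0 \<le> r n \<and> r n \<le> \<delta>'"
    using assms by (blast intro: order_trans)
  ultimately show "\<exists>x' r'. (\<Sum>n. ennreal (unit_ball_vol s * r n powr s)) =
      (\<Sum>n. ennreal (unit_ball_vol s * r' n powr s)) \<and>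
      A \<subseteq> (\<Union>n. ball (x' n) (r' n)) \<and> (\<forall>n. 0 \<le> r' n \<and> r' n \<le> \<delta>')"
    by (intro exI[of _ x] exI[of _ r] conjI refl)
qed

lemma tendsto_hausdorff_measure:
  "((\<lambda>\<delta>. hausdorff_content s \<delta> A) \<longlongrightarrow> hausdorff_measure s A) (at_right 0)"
proof -
  let ?S = "SUP \<delta>\<in>{0<..}. hausdorff_content s \<delta> A"
  have "((\<lambda>\<delta>. hausdorff_content s \<delta> A) \<longlongrightarrow> ?S) (at_right 0)"
  proof (rule order_tendstoI)
    fix a assume "a < ?S"
    then obtain d where d: "0 < d" "a < hausdorff_content s d A"
      by (auto simp: less_SUP_iff)
    show "\<forall>\<^sub>F \<delta> in at_right 0. a < hausdorff_content s \<delta> A"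
      using eventually_at_right_real[OF d(1)]
    proof eventually_elim
      case (elim \<delta>)
      then have "hausdorff_content s d A \<le> hausdorff_content s \<delta> A"
        by (intro hausdorff_content_antimono) simp
      with d(2) show ?case by (rule less_le_trans)
    qed
  next
    fix a assume a: "?S < a"
    show "\<forall>\<^sub>F \<delta> in at_right 0. hausdorff_content s \<delta> A < a"
      using eventually_at_right_less[of 0]
    proof eventually_elim
      case (elim \<delta>)
      have "hausdorff_content s \<delta> A \<le> ?S" by (rule SUP_upper) (use elim in simp)
      then show ?case using a by simp
    qed
  qed
  then show ?thesis
    unfolding hausdorff_measure_def by (simp add: tendsto_Lim)
qed

(* Signed Borel measures are represented by their real-valued set functions;
   only the values on Borel sets matter. *)
definition total_variation :: "('a::topological_space set \<Rightarrow> real) \<Rightarrow> 'a set \<Rightarrow> ennreal" where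
  "total_variation \<nu> A =
     (SUP E \<in> {E :: nat \<Rightarrow> 'a set.
                 range E \<subseteq> sets borel \<and> disjoint_family E \<and> (\<Union>n. E n) = A}.
        \<Sum>n. ennreal \<bar>\<nu> (E n)\<bar>)"

definition total_variation_norm :: "('a::topological_space set \<Rightarrow> real) \<Rightarrow> ennreal" where
  "total_variation_norm \<nu> = total_variation \<nu> UNIV"

end

theory Submission
  imports Defs
begin

text \<open>
  By Vitali's covering lemma, the set where the upper \<open>s\<close>-dimensional density of \<open>\<mu>\<close> exceeds
  \<open>t > 0\<close> has finite Hausdorff measure, hence is \<open>\<mu>\<close>-null; so the density vanishes almost everywhere.
  An Egorov argument yields an increasing sequence of sets \<open>E n\<close> that exhaust \<open>\<mu>\<close> and on each of
  which the density vanishes uniformly, and \<open>\<mu>s n\<close> is the restriction of \<open>\<mu>\<close> to \<open>E n\<close>. The uniform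
  bound extends from centres in \<open>E n\<close> to all centres because a ball that meets \<open>E n\<close> at \<open>y\<close>
  lies in the ball of twice the radius around \<open>y\<close>.
\<close>

text \<open>For \<open>t > 0\<close>, intersecting over all \<open>d > 0\<close> gives a set that
  contains the points of upper \<open>s\<close>-density above \<open>t\<close> and only points of
  upper density at least \<open>t\<close>. Keeping the scale \<open>d\<close> explicit yields sets
  that shrink with \<open>d\<close>, as an Egorov argument requires.\<close>

definition concentrated :: "'a::metric_space measure \<Rightarrow> real \<Rightarrow> real \<Rightarrow> real \<Rightarrow> 'a set" where
  "concentrated M s t d =
     {x. \<exists>r. 0 < r \<and> r \<le> d \<and> ennreal (t * r powr s) < emeasure M (ball x r)}"

lemma concentrated_mono: "d \<le> d' \<Longrightarrow> concentrated M s t d \<subseteq> concentrated M s t d'"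
  unfolding concentrated_def by force

text \<open>By continuity from below, a slightly smaller concentric ball already has measure above
  \<open>c\<close>, and \<open>ball y r\<close> contains it for every centre \<open>y\<close> close
  to \<open>x\<close>. This is what makes the \<open>concentrated\<close> sets Borel.\<close>

lemma open_less_emeasure_ball:
  fixes M :: "'a::metric_space measure"
  assumes M: "sets M = sets borel"
  shows "open {x. c < emeasure M (ball x r)}"
  unfolding open_dist
proof safe
  fix x assume x: "c < emeasure M (ball x r)"
  define A where "A n = ball x (r - inverse (real (Suc n)))" for n
  have inc: "incseq A"
  proof (rule incseq_SucI)
    fix n
    have "inverse (real (Suc (Suc n))) \<le> inverse (real (Suc n))" by (rule le_imp_inverse_le) auto
    then show "A n \<subseteq> A (Suc n)" unfolding A_def by (intro subset_ball) linarith
  qed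
  have "ball x r \<subseteq> (\<Union>n. A n)"
  proof
    fix y assume "y \<in> ball x r"
    then have "0 < r - dist x y" by simp
    then obtain n where "inverse (real (Suc n)) < r - dist x y"
      using reals_Archimedean by blast
    then have "y \<in> A n" unfolding A_def mem_ball by linarith
    then show "y \<in> (\<Union>n. A n)" by blast
  qed
  moreover have "A n \<subseteq> ball x r" for n
    unfolding A_def by (intro subset_ball) simp
  ultimately have "(\<Union>n. A n) = ball x r" by blast
  moreover have "range A \<subseteq> sets M" by (auto simp: A_def M)
  ultimately have "(SUP n. emeasure M (A n)) = emeasure M (ball x r)"
    using SUP_emeasure_incseq[OF _ inc, of M] by simp
  then obtain n where n: "c < emeasure M (A n)"
    using x by (metis less_SUP_iff)
  show "\<exists>e>0. \<forall>y. dist y x < e \<longrightarrow> y \<in> {x. c < emeasure M (ball x r)}"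
  proof (intro exI[of _ "inverse (real (Suc n))"] conjI allI impI)
    fix y assume y: "dist y x < inverse (real (Suc n))"
    have "A n \<subseteq> ball y r"
    proof
      fix z assume "z \<in> A n"
      then show "z \<in> ball y r"
        using y dist_triangle[of y z x] unfolding A_def mem_ball by linarith
    qed
    then have "emeasure M (A n) \<le> emeasure M (ball y r)"
      by (intro emeasure_mono) (auto simp: M)
    then show "y \<in> {x. c < emeasure M (ball x r)}" using n by (auto intro: less_le_trans)
  qed auto
qed

lemma open_concentrated:
  assumes "sets M = sets borel"
  shows "open (concentrated M s t d)"
proof -
  have "concentrated M s t d =
      (\<Union>r\<in>{0<..d}. {x. ennreal (t * r powr s) < emeasure M (ball x r)})"
    unfolding concentrated_def by auto
  then show ?thesis using open_less_emeasure_ball[OF assms] by auto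
qed

text \<open>Vitali's lemma selects disjoint balls of large mass whose fivefold enlargements cover
  \<open>A\<close>. Each enlarged ball costs at most a constant times the mass of the original one,
  so disjointness bounds the content by a multiple of the total mass, uniformly in \<delta>.\<close>

lemma hausdorff_measure_concentrated:
  fixes M :: "'a::euclidean_space measure"
  assumes M: "sets M = sets borel" and fin: "finite_measure M"
    and s: "0 \<le> s" and t: "0 < t"
    and A: "\<And>d. 0 < d \<Longrightarrow> A \<subseteq> concentrated M s t d"
  shows "hausdorff_measure s A < \<infinity>"
proof -
  \<comment> \<open>Chosen so that
    \<open>unit_ball_vol s * (5 * r) powr s = c * (t * r powr s)\<close> for
    \<open>r > 0\<close>.\<close>
  define c where "c = unit_ball_vol s * 5 powr s / t"
  have c: "0 \<le> c" using s t by (auto simp: c_def)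
  define B where "B = ennreal c * emeasure M UNIV"
  have bound: "hausdorff_content s \<delta> A \<le> B" if \<delta>: "0 < \<delta>" for \<delta>
  proof -
    \<comment> \<open>Radii at most \<open>\<delta> / 5\<close> keep the enlarged balls admissible
      at scale \<delta>.\<close>
    have "\<forall>x\<in>A. \<exists>r. 0 < r \<and> r \<le> \<delta> / 5 \<and> ennreal (t * r powr s) < emeasure M (ball x r)"
      using A[of "\<delta> / 5"] \<delta> unfolding concentrated_def by auto
    then obtain r where
      r: "\<And>x. x \<in> A \<Longrightarrow> 0 < r x \<and> r x \<le> \<delta> / 5"
      and rM: "\<And>x. x \<in> A \<Longrightarrow> ennreal (t * r x powr s) < emeasure M (ball x (r x))"
      by metis
    have "A \<subseteq> (\<Union>x\<in>A. ball x (r x))" using r by force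
    then obtain C where C: "countable C" "C \<subseteq> A"
      and dj: "pairwise (\<lambda>i j. disjnt (ball i (r i)) (ball j (r j))) C"
      and cov: "A \<subseteq> (\<Union>i\<in>C. ball i (5 * r i))"
      by (rule Vitali_covering_lemma_balls[OF _ r, where a = "\<lambda>x. x"]) blast+
    \<comment> \<open>\<open>C\<close> may be finite, whereas the content asks for a sequence of
      balls. Indices outside the image of \<open>C\<close> get radius 0, an empty ball whose cost is
      0 even for \<open>s = 0\<close>, since \<open>0 powr 0 = 0\<close>.\<close>
    define f where "f = to_nat_on C"
    have inj: "inj_on f C" unfolding f_def using C(1) by (rule inj_on_to_nat_on)
    define x where "x = inv_into C f"
    define R where "R n = (if n \<in> f ` C then 5 * r (x n) else 0)" for n
    define F where "F n = (if n \<in> f ` C then ball (x n) (r (x n)) else {})" for n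
    have xC: "x n \<in> C" if "n \<in> f ` C" for n
      using that unfolding x_def by (rule inv_into_into)
    have xf: "x (f i) = i" if "i \<in> C" for i
      using that inj unfolding x_def by simp
    have "A \<subseteq> (\<Union>n. ball (x n) (R n))"
    proof
      fix y assume "y \<in> A"
      then obtain i where i: "i \<in> C" "y \<in> ball i (5 * r i)" using cov by blast
      then have "y \<in> ball (x (f i)) (R (f i))" by (auto simp: R_def xf)
      then show "y \<in> (\<Union>n. ball (x n) (R n))" by blast
    qed
    moreover have "\<forall>n. 0 \<le> R n \<and> R n \<le> \<delta>"
    proof
      fix n
      show "0 \<le> R n \<and> R n \<le> \<delta>"
      proof (cases "n \<in> f ` C")
        case True
        then have "x n \<in> A" using xC C(2) by blast
        from r[OF this] show ?thesis using True by (simp add: R_def)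
      qed (use \<delta> in \<open>simp add: R_def\<close>)
    qed
    ultimately have "hausdorff_content s \<delta> A \<le> (\<Sum>n. ennreal (unit_ball_vol s * R n powr s))"
      unfolding hausdorff_content_def by (intro Inf_lower) blast
    also have "\<dots> \<le> (\<Sum>n. ennreal c * emeasure M (F n))"
    proof (rule suminf_le)
      fix n
      show "ennreal (unit_ball_vol s * R n powr s) \<le> ennreal c * emeasure M (F n)"
      proof (cases "n \<in> f ` C")
        case True
        then have xA: "x n \<in> A" using xC C(2) by blast
        have "unit_ball_vol s * R n powr s = c * (t * r (x n) powr s)"
          using True t r[OF xA] by (simp add: R_def c_def powr_mult)
        also have "ennreal \<dots> = ennreal c * ennreal (t * r (x n) powr s)"
          using c t by (intro ennreal_mult) auto
        also have "\<dots> \<le> ennreal c * emeasure M (F n)"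
          using True rM[OF xA] by (intro mult_left_mono) (auto simp: F_def)
        finally show ?thesis .
      qed (simp add: R_def)
    qed auto
    also have "\<dots> = ennreal c * (\<Sum>n. emeasure M (F n))" by simp
    also have "(\<Sum>n. emeasure M (F n)) = emeasure M (\<Union>n. F n)"
    proof (rule suminf_emeasure)
      show "range F \<subseteq> sets M" by (auto simp: F_def M)
      show "disjoint_family F"
        unfolding disjoint_family_on_def
      proof safe
        fix m n y assume mn: "m \<noteq> n" "y \<in> F m" "y \<in> F n"
        then have "m \<in> f ` C" "n \<in> f ` C" by (auto simp: F_def split: if_splits)
        moreover from this have "x m \<noteq> x n"
          using mn(1) by (metis x_def f_inv_into_f)
        ultimately have "disjnt (F m) (F n)"
          using dj xC unfolding F_def by (auto simp: pairwise_def)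
        then show "y \<in> {}" using mn by (auto simp: disjnt_iff)
      qed
    qed
    also have "ennreal c * \<dots> \<le> B"
      unfolding B_def by (intro mult_left_mono emeasure_mono) (auto simp: M)
    finally show ?thesis .
  qed
  have "hausdorff_measure s A \<le> B"
  proof (rule tendsto_upperbound[OF tendsto_hausdorff_measure])
    show "\<forall>\<^sub>F \<delta> in at_right 0. hausdorff_content s \<delta> A \<le> B"
      using eventually_at_right_less[of 0] by eventually_elim (rule bound)
  qed simp
  also have "B < \<infinity>"
  proof -
    have "emeasure M UNIV \<noteq> \<infinity>"
      using finite_measure.emeasure_finite[OF fin, of UNIV] by simp
    then show ?thesis unfolding B_def by (simp add: ennreal_mult_less_top less_top)
  qed
  finally show ?thesis .
qed

text \<open>The selection step of Egorov's theorem: continuity from above makes \<open>A k m\<close>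
  as small as desired for large \<open>m\<close>, and geometric weights summing to 1 keep the total
  over \<open>k\<close> at most \<open>e\<close>.\<close>

lemma (in finite_measure) emeasure_UN_decseq_le:
  fixes A :: "nat \<Rightarrow> nat \<Rightarrow> 'a set"
  assumes sets: "\<And>k m. A k m \<in> sets M" and dec: "\<And>k. decseq (A k)"
    and null: "\<And>k. emeasure M (\<Inter>m. A k m) = 0" and e: "0 < e"
  shows "\<exists>m. emeasure M (\<Union>k. A k (m k)) \<le> ennreal e"
proof -
  have "\<exists>m. emeasure M (A k m) < ennreal (e * (1 / 2) ^ Suc k)" for k
  proof -
    have "(\<lambda>m. emeasure M (A k m)) \<longlonglongrightarrow> 0"
      using Lim_emeasure_decseq[of "A k" M] sets dec null by (auto simp: emeasure_finite)
    from order_tendstoD(2)[OF this, of "ennreal (e * (1 / 2) ^ Suc k)"] e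
    show ?thesis by (auto simp: eventually_sequentially)
  qed
  then obtain m where m: "\<And>k. emeasure M (A k (m k)) < ennreal (e * (1 / 2) ^ Suc k)"
    by metis
  have "emeasure M (\<Union>k. A k (m k)) \<le> (\<Sum>k. emeasure M (A k (m k)))"
    using sets by (intro emeasure_subadditive_countably) auto
  also have "\<dots> \<le> (\<Sum>k. ennreal (e * (1 / 2) ^ Suc k))"
    using m by (intro suminf_le) (auto intro: less_imp_le)
  also have "\<dots> = ennreal e"
    using sums_mult[OF power_half_series, of e] e by (intro suminf_ennreal_eq) auto
  finally show ?thesis by blast
qed

text \<open>The condition \<open>2 * r \<le> d\<close> keeps the recentred ball within the scale at
  which points of \<open>E\<close> have small density; the price of recentring is the factor
  \<open>2 powr s\<close>.\<close>

lemma emeasure_Int_ball_le: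
  assumes M: "sets M = sets borel"
    and E: "E \<inter> concentrated M s t d = {}" and r: "0 < r" "2 * r \<le> d"
  shows "emeasure M (E \<inter> ball x r) \<le> ennreal (t * (2 * r) powr s)"
proof (cases "E \<inter> ball x r = {}")
  case False
  then obtain y where y: "y \<in> E" "y \<in> ball x r" by blast
  have "E \<inter> ball x r \<subseteq> ball y (2 * r)"
  proof
    fix z assume "z \<in> E \<inter> ball x r"
    then show "z \<in> ball y (2 * r)"
      using y dist_triangle[of y z x] by (simp add: dist_commute)
  qed
  then have "emeasure M (E \<inter> ball x r) \<le> emeasure M (ball y (2 * r))"
    by (intro emeasure_mono) (auto simp: M)
  moreover have "emeasure M (ball y (2 * r)) \<le> ennreal (t * (2 * r) powr s)"
  proof (rule ccontr)
    assume "\<not> ?thesis"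
    then have "y \<in> concentrated M s t d"
      unfolding concentrated_def using r by (auto simp: not_le intro!: exI[of _ "2 * r"])
    then show False using y(1) E by blast
  qed
  ultimately show ?thesis by (rule order_trans)
qed simp

text \<open>The difference is minus the restriction of \<open>M\<close> to \<open>- S\<close>, hence
  of constant sign, so every Borel partition contributes exactly the mass of
  \<open>- S\<close>.\<close>

lemma total_variation_norm_restrict_le:
  fixes M :: "'a::topological_space measure"
  assumes M: "sets M = sets borel" and fin: "finite_measure M" and S: "S \<in> sets borel"
  shows "total_variation_norm (\<lambda>A. measure (density M (indicator S)) A - measure M A)
    \<le> emeasure M (- S)"
  unfolding total_variation_norm_def total_variation_def
proof (rule SUP_least, safe)
  interpret finite_measure M by (rule fin)
  fix E :: "nat \<Rightarrow> 'a set"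
  assume E: "range E \<subseteq> sets borel" "disjoint_family E" "(\<Union>n. E n) = UNIV"
  have "ennreal \<bar>measure (density M (indicator S)) (E n) - measure M (E n)\<bar>
      = emeasure M (E n - S)" for n
  proof -
    have En: "E n \<in> sets M" and SM: "S \<in> sets M" using E S M by auto
    have "measure (density M (indicator S)) (E n) = measure M (S \<inter> E n)"
      using emeasure_restricted[OF SM En] by (simp add: measure_def)
    moreover have "measure M (E n) = measure M (S \<inter> E n) + measure M (E n - S)"
      using finite_measure_Union[of "S \<inter> E n" "E n - S"] En SM
      by (simp add: Int_commute[of S] Int_Diff_Un disjoint_iff)
    ultimately show ?thesis by (simp add: emeasure_eq_measure)
  qed
  then have "(\<Sum>n. ennreal \<bar>measure (density M (indicator S)) (E n) - measure M (E n)\<bar>)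
      = (\<Sum>n. emeasure M (E n - S))" by simp
  also have "\<dots> = emeasure M (\<Union>n. E n - S)"
    using E S M by (intro suminf_emeasure) (auto simp: disjoint_family_on_def)
  also have "(\<Union>n. E n - S) = - S" using E(3) by blast
  finally show "(\<Sum>n. ennreal \<bar>measure (density M (indicator S)) (E n) - measure M (E n)\<bar>)
      \<le> emeasure M (- S)" by simp
qed

theorem proposition1p3:
  fixes \<mu> :: "(real ^ 'n) measure"
  assumes "finite_measure \<mu>" and "sets \<mu> = sets borel"
    and "\<And>A. A \<in> sets borel \<Longrightarrow> hausdorff_measure (real CARD('n) - 1) A < \<infinity>
           \<Longrightarrow> emeasure \<mu> A = 0"
  shows "\<exists>\<mu>s :: nat \<Rightarrow> (real ^ 'n) measure.
           (\<forall>n. finite_measure (\<mu>s n) \<and> sets (\<mu>s n) = sets borel) \<and>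
           (\<forall>n. \<forall>A \<in> sets borel. emeasure (\<mu>s n) A \<le> emeasure (\<mu>s (Suc n)) A) \<and>
           (\<lambda>n. total_variation_norm (\<lambda>A. measure (\<mu>s n) A - measure \<mu> A)) \<longlonglongrightarrow> 0 \<and>
           (\<forall>n. ((\<lambda>\<delta>. SUP (x, r) \<in> {(x, r). 0 < r \<and> r \<le> \<delta>}.
                     emeasure (\<mu>s n) (ball x r) / ennreal (r ^ (CARD('n) - 1)))
                  \<longlongrightarrow> 0) (at_right 0))"
proof -
  interpret finite_measure \<mu> by (rule assms(1))
  define s where "s = real CARD('n) - 1"
  have s: "0 \<le> s" unfolding s_def using zero_less_card_finite[where 'a = 'n] by linarith
  \<comment> \<open>Positivity of \<open>r\<close> matters: in dimension one
    \<open>0 ^ 0 = 1\<close> but \<open>0 powr 0 = 0\<close>.\<close>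
  have pow: "r ^ (CARD('n) - 1) = r powr s" if "0 < r" for r :: real
    using powr_realpow[OF that, of "CARD('n) - 1"] zero_less_card_finite[where 'a = 'n]
    by (simp add: s_def of_nat_diff Suc_leI)
  \<comment> \<open>One null sequence serves as density threshold \<open>h k\<close>, as scale
    \<open>h m\<close> and as mass tolerance \<open>h n\<close>.\<close>
  define h :: "nat \<Rightarrow> real" where "h m = 1 / Suc m" for m
  have h0: "0 < h m" for m by (simp add: h_def)
  have h_mono: "h n \<le> h m" if "m \<le> n" for m n
    using that by (simp add: h_def frac_le)
  have h_less: "\<exists>m. h m < e" if "0 < e" for e
    using nat_approx_posE[OF that] unfolding h_def by metis
  define D where "D k m = concentrated \<mu> s (h k) (h m)" for k m
  have D_sets: "D k m \<in> sets borel" for k m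
    unfolding D_def using open_concentrated[OF assms(2)] by simp
  have D_dec: "decseq (D k)" for k
    unfolding D_def decseq_def by (intro allI impI concentrated_mono h_mono)
  have "emeasure \<mu> (\<Inter>m. D k m) = 0" for k
  proof (rule assms(3))
    have "(\<Inter>m. D k m) \<subseteq> concentrated \<mu> s (h k) d" if "0 < d" for d
    proof -
      obtain m where "h m < d" using h_less[OF \<open>0 < d\<close>] by blast
      then have "D k m \<subseteq> concentrated \<mu> s (h k) d"
        unfolding D_def by (intro concentrated_mono) simp
      then show ?thesis by blast
    qed
    then show "hausdorff_measure (real CARD('n) - 1) (\<Inter>m. D k m) < \<infinity>"
      using hausdorff_measure_concentrated[OF assms(2,1) s h0] unfolding s_def by blast
  qed (use D_sets in auto)
  then have "\<exists>m. emeasure \<mu> (\<Union>k. D k (m k)) \<le> ennreal (h n)" for n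
    using D_sets D_dec h0 by (intro emeasure_UN_decseq_le) (auto simp: assms(2))
  then obtain m where m: "\<And>n. emeasure \<mu> (\<Union>k. D k (m n k)) \<le> ennreal (h n)"
    by metis
  \<comment> \<open>The scales \<open>m n k\<close> are chosen separately for each \<open>n\<close>,
    so the individual complements need not be nested; the union over \<open>i \<le> n\<close> makes
    \<open>E\<close> increasing.\<close>
  define E where "E n = (\<Union>i\<le>n. - (\<Union>k. D k (m i k)))" for n
  have E_sets: "E n \<in> sets borel" for n
    unfolding E_def using D_sets by auto
  have E_compl: "emeasure \<mu> (- E n) \<le> ennreal (h n)" for n
  proof -
    have "emeasure \<mu> (- E n) \<le> emeasure \<mu> (\<Union>k. D k (m n k))"
      unfolding E_def by (intro emeasure_mono) (use D_sets assms(2) in auto)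
    then show ?thesis using m by (rule order_trans)
  qed
  have E_conc: "\<exists>j. E n \<inter> D k j = {}" for n k
  proof -
    \<comment> \<open>Only finitely many \<open>i\<close> enter \<open>E n\<close>, and
      \<open>D k\<close> is decreasing, so the finest of their scales works for all of them.\<close>
    define j where "j = Max ((\<lambda>i. m i k) ` {..n})"
    have "D k j \<subseteq> D k (m i k)" if "i \<le> n" for i
      using D_dec[of k] that unfolding j_def decseq_def by (simp add: Max_ge)
    then have "E n \<inter> D k j = {}" unfolding E_def by blast
    then show ?thesis by blast
  qed
  define \<mu>s where "\<mu>s n = density \<mu> (indicator (E n))" for n
  have \<mu>s_sets: "sets (\<mu>s n) = sets borel" for n
    by (simp add: \<mu>s_def assms(2))
  have \<mu>s: "emeasure (\<mu>s n) A = emeasure \<mu> (E n \<inter> A)" if "A \<in> sets borel" for n A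
    unfolding \<mu>s_def using that E_sets assms(2) by (intro emeasure_restricted) auto
  show ?thesis
  proof (intro exI[of _ \<mu>s] conjI allI ballI)
    fix n
    show "finite_measure (\<mu>s n)"
    proof
      have "space (\<mu>s n) = UNIV" using sets_eq_imp_space_eq[OF \<mu>s_sets] by simp
      then show "emeasure (\<mu>s n) (space (\<mu>s n)) \<noteq> \<infinity>" by (simp add: \<mu>s emeasure_finite)
    qed
    show "sets (\<mu>s n) = sets borel" by (rule \<mu>s_sets)
  next
    fix n and A :: "(real ^ 'n) set" assume A: "A \<in> sets borel"
    have "E n \<subseteq> E (Suc n)" unfolding E_def by (intro UN_mono) auto
    then show "emeasure (\<mu>s n) A \<le> emeasure (\<mu>s (Suc n)) A"
      using A E_sets by (auto simp: \<mu>s assms(2) intro!: emeasure_mono)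
  next
    have "(\<lambda>n. ennreal (h n)) \<longlonglongrightarrow> 0"
      unfolding h_def using tendsto_ennrealI[OF LIMSEQ_Suc[OF lim_1_over_n[where 'a = real]]]
      by simp
    then show "(\<lambda>n. total_variation_norm (\<lambda>A. measure (\<mu>s n) A - measure \<mu> A)) \<longlonglongrightarrow> 0"
    proof (rule tendsto_sandwich[OF _ _ tendsto_const, rotated 2])
      show "\<forall>\<^sub>F n in sequentially.
          total_variation_norm (\<lambda>A. measure (\<mu>s n) A - measure \<mu> A) \<le> ennreal (h n)"
        unfolding \<mu>s_def
        using total_variation_norm_restrict_le[OF assms(2,1) E_sets] E_compl
        by (intro always_eventually allI) (rule order_trans)
    qed simp
  next
    fix n
    show "((\<lambda>\<delta>. SUP (x, r) \<in> {(x, r). 0 < r \<and> r \<le> \<delta>}.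
            emeasure (\<mu>s n) (ball x r) / ennreal (r ^ (CARD('n) - 1))) \<longlongrightarrow> 0) (at_right 0)"
      (is "(?f \<longlongrightarrow> 0) _")
    proof (rule order_tendstoI)
      fix a :: ennreal assume a: "0 < a"
      \<comment> \<open>The tolerance \<open>a\<close> may be infinite; an intermediate value is
        finite, and it turns the non-strict bound on the supremum into a strict one.\<close>
      obtain b where b: "0 < b" "b < a" using dense[OF a] by blast
      have "b < top" using b(2) top_greatest by (rule less_le_trans)
      then have e: "0 < enn2real b" "ennreal (enn2real b) < a"
        using b by (auto simp: enn2real_positive_iff)
      define e where "e = enn2real b"
      note e = e[folded e_def]
      \<comment> \<open>This threshold absorbs the factor \<open>2 powr s\<close> lost by
        recentring.\<close>
      obtain k where k: "h k < e / 2 powr s" using h_less[of "e / 2 powr s"] e by auto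
      obtain j where j: "E n \<inter> D k j = {}" using E_conc by blast
      \<comment> \<open>Halving \<open>h j\<close> guarantees \<open>2 * r \<le> h j\<close> for all
        radii \<open>r \<le> \<delta>\<close>.\<close>
      have bound: "?f \<delta> \<le> ennreal e" if \<delta>: "\<delta> < h j / 2" for \<delta>
      proof (rule SUP_least, clarify)
        fix x :: "real ^ 'n" and r :: real assume r: "0 < r" "r \<le> \<delta>"
        have "emeasure (\<mu>s n) (ball x r) \<le> ennreal (h k * (2 * r) powr s)"
          using emeasure_Int_ball_le[OF assms(2) j[unfolded D_def] r(1)] r \<delta>
          by (simp add: \<mu>s)
        also have "\<dots> \<le> ennreal (e * r powr s)"
          using k r by (intro ennreal_leI) (simp add: powr_mult field_simps)
        finally have "emeasure (\<mu>s n) (ball x r) / ennreal (r ^ (CARD('n) - 1))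
            \<le> ennreal (e * r powr s) / ennreal (r powr s)"
          unfolding pow[OF r(1)] by (rule divide_right_mono_ennreal)
        also have "\<dots> = ennreal e"
          using r(1) e(1) by (simp add: divide_ennreal)
        finally show "emeasure (\<mu>s n) (ball x r) / ennreal (r ^ (CARD('n) - 1)) \<le> ennreal e" .
      qed
      show "\<forall>\<^sub>F \<delta> in at_right 0. ?f \<delta> < a"
      proof (rule eventually_mono)
        show "\<forall>\<^sub>F \<delta> in at_right 0. \<delta> \<in> {0<..<h j / 2}"
          using h0[of j] by (intro eventually_at_right_real) simp
        show "?f \<delta> < a" if "\<delta> \<in> {0<..<h j / 2}" for \<delta>
          using that by (intro le_less_trans[OF bound e(2)]) simp
      qed
    qed simp
  qed
qed

end
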